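(* Let $F$ be a field with $\operatorname{Char}(F)\neq 2$ and let $R$ be a simple associative unital $F$-algebra. Let $*$ be an involution on $R$ of the first kind with set of symmetric elements $S$ and set of skew-symmetric elements $K$, and assume $S\subsetneq R$. Assume $S$ is not a commutative set. Then $SKS=R$.
   Context: $S=\{r\in R: r^*=r\}$ and $K=\{r\in R: r^*=-r\}$. The involution $*$ is of the first kind if $Z(R)\subseteq S$, where $Z(R)$ is the center of $R$. A subset $A\subseteq R$ is a commutative set if $xy=yx$ for all $x,y\in A$. $SKS$ denotes the $F$-subspace of $R$ generated by all products $akb$ with $a,b\in S$, $k\in K$. *)

theory Defs
  imports Complex_Main
begin

locale unital_assoc_algebra = vector_space scale
  for scale :: "'f::field \<Rightarrow> 'r::ring_1 \<Rightarrow> 'r" (infixr "*s" 75) +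
  assumes scale_mult_left: "(c *s x) * y = c *s (x * y)"
    and scale_mult_right: "x * (c *s y) = c *s (x * y)"

(* Closure under negation follows from absorption of - 1. *)
definition two_sided_ideal :: "'r::ring_1 set \<Rightarrow> bool" where
  "two_sided_ideal I \<longleftrightarrow>
     0 \<in> I \<and> (\<forall>x\<in>I. \<forall>y\<in>I. x + y \<in> I) \<and> (\<forall>x\<in>I. \<forall>r. r * x \<in> I \<and> x * r \<in> I)"

(* Nontriviality of R, and hence R^2 \<noteq> 0, is built into the class ring_1.
   Because R is unital, ring ideals are automatically F-subspaces. *)
definition simple_ring :: "'r::ring_1 itself \<Rightarrow> bool" where
  "simple_ring _ \<longleftrightarrow> (\<forall>I::'r set. two_sided_ideal I \<longrightarrow> I = {0} \<or> I = UNIV)"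

(* No F-linearity is required; for an involution of the first kind it is a
   consequence, as F * 1 lies in the center. *)
definition involution :: "('r::ring_1 \<Rightarrow> 'r) \<Rightarrow> bool" where
  "involution star \<longleftrightarrow>
     (\<forall>x y. star (x + y) = star x + star y) \<and>
     (\<forall>x y. star (x * y) = star y * star x) \<and>
     (\<forall>x. star (star x) = x)"

definition symmetric_elements :: "('r::ring_1 \<Rightarrow> 'r) \<Rightarrow> 'r set" where
  "symmetric_elements star = {r. star r = r}"

definition skew_elements :: "('r::ring_1 \<Rightarrow> 'r) \<Rightarrow> 'r set" where
  "skew_elements star = {r. star r = - r}"

definition ring_center :: "'r::ring_1 set" where
  "ring_center = {z. \<forall>r. z * r = r * z}"

definition first_kind :: "('r::ring_1 \<Rightarrow> 'r) \<Rightarrow> bool" where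
  "first_kind star \<longleftrightarrow> ring_center \<subseteq> symmetric_elements star"

definition commutative_set :: "'r::ring_1 set \<Rightarrow> bool" where
  "commutative_set A \<longleftrightarrow> (\<forall>x\<in>A. \<forall>y\<in>A. x * y = y * x)"

context unital_assoc_algebra
begin

definition triple_product_space :: "'r set \<Rightarrow> 'r set \<Rightarrow> 'r set \<Rightarrow> 'r set" where
  "triple_product_space A B C = span {a * b * c | a b c. a \<in> A \<and> b \<in> B \<and> c \<in> C}"

end

end

theory Submission
  imports Defs
begin

text \<open>
  Write \<open>T\<close> for the span of \<open>SKS\<close> and \<open>L\<close> for the set of commutators \<open>[a, b]\<close> of symmetric
  elements. By hypothesis \<open>L\<close> contains a nonzero element, so by simplicity it is enough to show
  \<open>R L R \<subseteq> T\<close>: the largest two-sided ideal inside \<open>T\<close> is then nonzero, hence all of \<open>R\<close>.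

  The first observation is that \<open>SSK \<subseteq> T\<close>. For symmetric \<open>a\<close>, \<open>s\<close> and skew \<open>k\<close> the element
  \<open>sk + ks\<close> is again skew, so \<open>a(sk + ks)\<close> and \<open>aks\<close> lie in \<open>T\<close>, and their difference is \<open>ask\<close>.
  Hence \<open>LK \<subseteq> T\<close>. Since commutators of symmetric elements are skew, also \<open>LS \<subseteq> T\<close>; and
  \<open>R = S + K\<close> because \<open>2\<close> is invertible. Together these give \<open>LR \<subseteq> T\<close>.

  A left factor is now moved to the right of \<open>u \<in> L\<close> at the price of a commutator. For skew \<open>k\<close>,
  \<open>k u r = [k, u] r + u (k r)\<close>, and \<open>[k, u]\<close> is a sum of two elements of \<open>L\<close> by the Jacobi
  identity, as \<open>[K, S] \<subseteq> S\<close>. For symmetric \<open>s\<close>, the product \<open>s u s'\<close> with \<open>s'\<close> symmetric is in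
  \<open>SKS\<close>, while \<open>s u k = [s, u] k + u (s k)\<close> with \<open>[s, u]\<close> symmetric.
\<close>

text \<open>
  The elements \<open>y\<close> with \<open>R y R \<subseteq> T\<close> form the largest two-sided ideal contained in \<open>T\<close>; if it is
  nonzero, simplicity puts \<open>1\<close> into it.
\<close>

lemma simple_ring_subgroup_eq_UNIV:
  fixes T :: "'r::ring_1 set"
  assumes "simple_ring TYPE('r)"
    and zero: "0 \<in> T"
    and add: "\<And>x y. x \<in> T \<Longrightarrow> y \<in> T \<Longrightarrow> x + y \<in> T"
    and "x \<noteq> 0"
    and x: "\<And>r r'. r * x * r' \<in> T"
  shows "T = UNIV"
proof -
  define I where "I = {y. \<forall>r r'. r * y * r' \<in> T}"
  have "two_sided_ideal I"
    unfolding two_sided_ideal_def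
  proof (intro conjI ballI allI)
    show "0 \<in> I"
      using zero by (simp add: I_def)
    show "y + z \<in> I" if "y \<in> I" "z \<in> I" for y z
      using that by (simp add: I_def distrib_left distrib_right add)
    fix y r assume y: "y \<in> I"
    have "p * (r * y) * q \<in> T" for p q
      using y unfolding I_def mult.assoc[symmetric] by blast
    then show "r * y \<in> I"
      by (simp add: I_def)
    have "p * (y * r) * q = p * y * (r * q)" for p q
      by (simp add: mult.assoc)
    with y show "y * r \<in> I"
      by (simp add: I_def)
  qed
  moreover have "x \<in> I"
    using x by (simp add: I_def)
  ultimately have "I = UNIV"
    using assms(1) \<open>x \<noteq> 0\<close> unfolding simple_ring_def by blast
  then have "1 \<in> I"
    by blast
  have "r \<in> T" for r
  proof -
    have "r * 1 * 1 \<in> T"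
      using \<open>1 \<in> I\<close> unfolding I_def by blast
    then show ?thesis
      by simp
  qed
  then show ?thesis
    by blast
qed

lemma two_neq_0_of_char:
  assumes "CHAR('f::field) \<noteq> 2"
  shows "(2::'f) \<noteq> 0"
proof
  assume "(2::'f) = 0"
  then have "of_nat 2 = (0::'f)"
    by simp
  then have "CHAR('f) dvd 2"
    by (simp only: of_nat_eq_0_iff_char_dvd)
  then have "CHAR('f) \<le> 2"
    by (rule dvd_imp_le) simp
  moreover have "CHAR('f) \<noteq> 0"
    using \<open>CHAR('f) dvd 2\<close> by (intro notI) simp
  moreover have "CHAR('f) \<noteq> 1"
    by simp
  ultimately show False
    using assms by linarith
qed

locale involutive_algebra = unital_assoc_algebra scale
  for scale :: "'f::field \<Rightarrow> 'r::ring_1 \<Rightarrow> 'r" (infixr "*s" 75) +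
  fixes star :: "'r \<Rightarrow> 'r"
  assumes involution: "involution star"
    and two_neq_0: "(2::'f) \<noteq> 0"
begin

abbreviation S where "S \<equiv> symmetric_elements star"
abbreviation K where "K \<equiv> skew_elements star"
abbreviation T where "T \<equiv> triple_product_space S K S"

definition commutator :: "'r \<Rightarrow> 'r \<Rightarrow> 'r" where
  "commutator x y = x * y - y * x"

lemma star_add: "star (x + y) = star x + star y"
  and star_mult: "star (x * y) = star y * star x"
  and star_star: "star (star x) = x"
  using involution by (simp_all add: involution_def)

lemma star_diff: "star (x - y) = star x - star y"
  using star_add[of "x - y" y] by simp

text \<open>
  The map \<open>star\<close> is only assumed additive, but halving commutes with every additive map.
\<close>

lemma symmetric_skew_decomposition:
  obtains s k where "s \<in> S" "k \<in> K" "r = s + k"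
proof
  define h where "h = (1 / 2) *s r"
  have "h + h = (1 / 2 + 1 / 2) *s r"
    unfolding h_def by (rule scale_left_distrib[symmetric])
  also have "1 / 2 + 1 / 2 = (1::'f)"
    using two_neq_0 by (simp add: field_simps)
  finally have h: "h + h = r"
    by simp
  show "h + star h \<in> S"
    by (simp add: symmetric_elements_def star_add star_star add.commute)
  show "h - star h \<in> K"
    by (simp add: skew_elements_def star_diff star_star)
  show "r = (h + star h) + (h - star h)"
    using h by simp
qed

lemma commutator_symmetric: "a \<in> S \<Longrightarrow> b \<in> S \<Longrightarrow> commutator a b \<in> K"
  and commutator_symmetric_skew: "a \<in> S \<Longrightarrow> k \<in> K \<Longrightarrow> commutator a k \<in> S"
  and commutator_skew_symmetric: "k \<in> K \<Longrightarrow> a \<in> S \<Longrightarrow> commutator k a \<in> S"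
  and anticommutator_symmetric_skew: "a \<in> S \<Longrightarrow> k \<in> K \<Longrightarrow> a * k + k * a \<in> K"
  by (simp_all add: commutator_def symmetric_elements_def skew_elements_def star_add star_diff
      star_mult)

lemma one_symmetric: "1 \<in> S"
  using star_mult[of 1 "star 1"] by (simp add: symmetric_elements_def star_star)

lemma T_add: "x \<in> T \<Longrightarrow> y \<in> T \<Longrightarrow> x + y \<in> T"
  and T_diff: "x \<in> T \<Longrightarrow> y \<in> T \<Longrightarrow> x - y \<in> T"
  and T_zero: "0 \<in> T"
  unfolding triple_product_space_def by (fact span_add span_diff span_zero)+

lemma T_SKS: "a \<in> S \<Longrightarrow> k \<in> K \<Longrightarrow> b \<in> S \<Longrightarrow> a * k * b \<in> T"
  unfolding triple_product_space_def by (rule span_base) blast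

lemma T_SK: "a \<in> S \<Longrightarrow> k \<in> K \<Longrightarrow> a * k \<in> T"
  using T_SKS[OF _ _ one_symmetric] by simp

lemma T_KS: "k \<in> K \<Longrightarrow> b \<in> S \<Longrightarrow> k * b \<in> T"
  using T_SKS[OF one_symmetric] by simp

text \<open>The anticommutator \<open>sk + ks\<close> is skew, so \<open>ask\<close> and \<open>-aks\<close> agree modulo \<open>SK\<close>.\<close>

lemma T_SSK:
  assumes "a \<in> S" "s \<in> S" "k \<in> K"
  shows "a * s * k \<in> T"
proof -
  have "a * (s * k + k * s) - a * k * s \<in> T"
    using assms by (intro T_diff T_SK T_SKS anticommutator_symmetric_skew)
  then show ?thesis
    by (simp add: algebra_simps)
qed

lemma T_commutator_right:
  assumes "a \<in> S" "b \<in> S"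
  shows "commutator a b * r \<in> T"
proof -
  obtain s k where "s \<in> S" "k \<in> K" and r: "r = s + k"
    by (rule symmetric_skew_decomposition)
  have "commutator a b * s \<in> T"
    using assms \<open>s \<in> S\<close> by (intro T_KS commutator_symmetric)
  moreover have "commutator a b * k \<in> T"
    using T_diff[OF T_SSK T_SSK] assms \<open>k \<in> K\<close> by (simp add: commutator_def left_diff_distrib)
  ultimately show ?thesis
    by (simp add: r distrib_left T_add)
qed

text \<open>
  By the Jacobi identity \<open>[k, [a, b]] = [[k, a], b] + [a, [k, b]]\<close>, and \<open>[k, a]\<close>, \<open>[k, b]\<close> are
  symmetric; so commuting \<open>k\<close> past \<open>[a, b]\<close> leaves only commutators of symmetric elements on the
  left.
\<close>

lemma T_skew_commutator:
  assumes "a \<in> S" "b \<in> S" "k \<in> K"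
  shows "k * commutator a b * r \<in> T"
proof -
  have "k * commutator a b * r =
      commutator (commutator k a) b * r + commutator a (commutator k b) * r
        + commutator a b * (k * r)"
    by (simp add: commutator_def algebra_simps)
  also have "\<dots> \<in> T"
    using assms by (intro T_add T_commutator_right commutator_skew_symmetric)
  finally show ?thesis .
qed

lemma T_symmetric_commutator:
  assumes "a \<in> S" "b \<in> S" "s \<in> S"
  shows "s * commutator a b * r \<in> T"
proof -
  obtain s' k where "s' \<in> S" "k \<in> K" and r: "r = s' + k"
    by (rule symmetric_skew_decomposition)
  have "s * commutator a b * s' \<in> T"
    using assms \<open>s' \<in> S\<close> by (intro T_SKS commutator_symmetric)
  moreover have "s * commutator a b * k \<in> T"
  proof -
    have "s * commutator a b * k =
        commutator s (commutator a b) * k + commutator a b * (s * k)"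
      by (simp add: commutator_def algebra_simps)
    also have "\<dots> \<in> T"
      using assms \<open>k \<in> K\<close>
      by (intro T_add T_SK T_commutator_right commutator_symmetric_skew commutator_symmetric)
    finally show ?thesis .
  qed
  ultimately show ?thesis
    by (simp add: r distrib_left T_add)
qed

lemma T_commutator_two_sided:
  assumes "a \<in> S" "b \<in> S"
  shows "r * commutator a b * r' \<in> T"
proof -
  obtain s k where "s \<in> S" "k \<in> K" and r: "r = s + k"
    by (rule symmetric_skew_decomposition)
  then show ?thesis
    using T_add[OF T_symmetric_commutator T_skew_commutator] assms
    by (simp add: distrib_right)
qed

lemma T_eq_UNIV:
  assumes "simple_ring TYPE('r)" and "\<not> commutative_set S"
  shows "T = UNIV"
proof -
  obtain a b where ab: "a \<in> S" "b \<in> S" and "commutator a b \<noteq> 0"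
    using assms(2) by (auto simp: commutative_set_def commutator_def)
  then show ?thesis
    using simple_ring_subgroup_eq_UNIV[OF assms(1) T_zero T_add] T_commutator_two_sided[OF ab]
    by blast
qed

end

theorem corollary3p15:
  fixes scale :: "'f::field \<Rightarrow> 'r::ring_1 \<Rightarrow> 'r"
    and star :: "'r \<Rightarrow> 'r"
    and S K :: "'r set"
  assumes "CHAR('f) \<noteq> 2"
    and "unital_assoc_algebra scale"
    and "simple_ring TYPE('r)"
    and "involution star"
    and "first_kind star"
    and "S = symmetric_elements star"
    and "K = skew_elements star"
    and "S \<subset> UNIV"
    and "\<not> commutative_set S"
  shows "unital_assoc_algebra.triple_product_space scale S K S = UNIV"
proof -
  interpret unital_assoc_algebra scale
    by fact
  interpret involutive_algebra scale star
    by unfold_locales (use assms(1,4) two_neq_0_of_char in blast)+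
  show ?thesis
    using T_eq_UNIV assms(3,6,7,9) by blast
qed

end
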